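(* Let $I\subset\mathbb{Z}^d$ be a non-empty finite set with $I\neq\{0\}$. For $p\in[0,1]$ consider the percolation Markov decision process (PMDP) on $\mathbb{Z}^d$ with action set $I$ and i.i.d. $\mathrm{Bernoulli}(p)$ payoffs, and let $v_\infty(p)$ be its limit value. Then the function $p\mapsto v_\infty(p)$ is Lipschitz on $[p_0,1]$ for every $p_0>0$. Moreover, if the PMDP is oriented (that is, $0\notin\operatorname{conv}(I)$), then $p\mapsto v_\infty(p)$ is also continuous at $p=0$.
   Context: A PMDP on $\mathbb{Z}^d$ is a tuple $(I,\mathcal{E},g)$ where $I\subset\mathbb{Z}^d$ is a non-empty finite set (the action set), $\mathcal{E}=(\Omega,\mathscr{F},\mathbb{P})$ is a probability space, and $g=\{\omega\mapsto g_\omega(z,i)\}_{(z,i)\in\mathbb{Z}^d\times I}$ is a collection of uniformly bounded, i.i.d. real-valued random variables on $\Omega$ (here each $\mathrm{Bernoulli}(p)$). Let $\mathcal{F}_{\mathrm{all}}=\sigma(\{\omega\mapsto g_\omega(z,i): z\in\mathbb{Z}^d,i\in I\})$. A strategy is a sequence $\sigma=(\sigma_m)_{m\ge1}$ of mappings $\sigma_m:\Omega\times\mathbb{Z}^d\to I$, each measurable with respect to $\mathcal{F}_{\mathrm{all}}\otimes\mathcal{P}(\mathbb{Z}^d)$; $\Sigma$ is the set of strategies. Given an initial state $z$ and $\omega$, $\sigma$ induces the play $z_1=z$, $i_m=\sigma_m(\omega,z)$, $z_{m+1}=z_m+i_m$ for $m\ge1$. The $n$-stage payoff is $\gamma_n^\omega(z,\sigma)=\frac1n\sum_{m=1}^n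 g_\omega(z_m,i_m)$ and the $n$-stage value is $v_n^\omega(z)=\max_{\sigma\in\Sigma}\gamma_n^\omega(z,\sigma)$. The limit value is the $\mathbb{P}$-almost sure limit of $v_n(z)$ as $n\to\infty$; for $I\ne\{0\}$ it exists and is a deterministic constant independent of $z$, denoted $v_\infty(p)$ here. *)

theory Defs
  imports "HOL-Probability.Probability"
begin

text \<open>The lattice \<open>\<int>\<^sup>d\<close> is the type \<open>int ^ 'd\<close> with \<open>d = CARD('d)\<close>.  Payoffs are written
  \<open>g \<omega> z i\<close>; only the values with \<open>i \<in> I\<close> matter.\<close>

locale PMDP = prob_space M
  for I :: "(int ^ 'd) set" and M :: "'w measure"
    and g :: "'w \<Rightarrow> int ^ 'd \<Rightarrow> int ^ 'd \<Rightarrow> real" +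
  assumes finite_actions: "finite I"
    and nonempty_actions: "I \<noteq> {}"
    and uniformly_bounded:
      "\<exists>C. \<forall>\<omega>\<in>space M. \<forall>z. \<forall>i\<in>I. \<bar>g \<omega> z i\<bar> \<le> C"
    and independent: "indep_vars (\<lambda>_. borel) (\<lambda>(z, i) \<omega>. g \<omega> z i) (UNIV \<times> I)"
    and identically_distributed:
      "\<And>z i z' i'. i \<in> I \<Longrightarrow> i' \<in> I \<Longrightarrow>
        distr M borel (\<lambda>\<omega>. g \<omega> z i) = distr M borel (\<lambda>\<omega>. g \<omega> z' i')"

locale bernoulli_PMDP = PMDP I M g
  for I :: "(int ^ 'd) set" and M :: "'w measure"
    and g :: "'w \<Rightarrow> int ^ 'd \<Rightarrow> int ^ 'd \<Rightarrow> real" +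
  fixes p :: real
  assumes prob_range: "p \<in> {0..1}"
    and bernoulli_payoffs:
      "\<And>z i. i \<in> I \<Longrightarrow>
        distr M borel (\<lambda>\<omega>. g \<omega> z i) = distr (measure_pmf (bernoulli_pmf p)) borel of_bool"

definition F_all ::
  "(int ^ 'd) set \<Rightarrow> 'w measure \<Rightarrow> ('w \<Rightarrow> int ^ 'd \<Rightarrow> int ^ 'd \<Rightarrow> real) \<Rightarrow> 'w measure" where
  "F_all I M g = sigma (space M)
     {(\<lambda>\<omega>. g \<omega> z i) -` A \<inter> space M | z i A. i \<in> I \<and> A \<in> sets borel}"

text \<open>Stages are counted from 0: \<open>\<sigma> m\<close> and \<open>state \<sigma> \<omega> z m\<close> are the usual \<open>\<sigma>\<^bsub>m+1\<^esub>\<close> and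
  \<open>z\<^bsub>m+1\<^esub>\<close>.\<close>

definition strategies ::
  "(int ^ 'd) set \<Rightarrow> 'w measure \<Rightarrow> ('w \<Rightarrow> int ^ 'd \<Rightarrow> int ^ 'd \<Rightarrow> real) \<Rightarrow>
    (nat \<Rightarrow> 'w \<Rightarrow> int ^ 'd \<Rightarrow> int ^ 'd) set" where
  "strategies I M g =
     {\<sigma>. \<forall>m. (\<lambda>(\<omega>, z). \<sigma> m \<omega> z) \<in> F_all I M g \<Otimes>\<^sub>M count_space UNIV \<rightarrow>\<^sub>M count_space I}"

primrec state ::
  "(nat \<Rightarrow> 'w \<Rightarrow> int ^ 'd \<Rightarrow> int ^ 'd) \<Rightarrow> 'w \<Rightarrow> int ^ 'd \<Rightarrow> nat \<Rightarrow> int ^ 'd" where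
  "state \<sigma> \<omega> z 0 = z"
| "state \<sigma> \<omega> z (Suc m) = state \<sigma> \<omega> z m + \<sigma> m \<omega> z"

definition payoff ::
  "('w \<Rightarrow> int ^ 'd \<Rightarrow> int ^ 'd \<Rightarrow> real) \<Rightarrow> nat \<Rightarrow> 'w \<Rightarrow> int ^ 'd \<Rightarrow>
    (nat \<Rightarrow> 'w \<Rightarrow> int ^ 'd \<Rightarrow> int ^ 'd) \<Rightarrow> real" where
  "payoff g n \<omega> z \<sigma> = (\<Sum>m<n. g \<omega> (state \<sigma> \<omega> z m) (\<sigma> m \<omega> z)) / real n"

text \<open>For fixed \<open>n\<close>, \<open>\<omega> \<in> space M\<close> and \<open>z\<close> there are at most \<open>card I ^ n\<close> plays, so the set of
  payoffs is finite although the set of strategies need not be.\<close>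

definition stage_value ::
  "(int ^ 'd) set \<Rightarrow> 'w measure \<Rightarrow> ('w \<Rightarrow> int ^ 'd \<Rightarrow> int ^ 'd \<Rightarrow> real) \<Rightarrow>
    nat \<Rightarrow> 'w \<Rightarrow> int ^ 'd \<Rightarrow> real" where
  "stage_value I M g n \<omega> z = Max (payoff g n \<omega> z ` strategies I M g)"

definition is_limit_value ::
  "(int ^ 'd) set \<Rightarrow> 'w measure \<Rightarrow> ('w \<Rightarrow> int ^ 'd \<Rightarrow> int ^ 'd \<Rightarrow> real) \<Rightarrow> real \<Rightarrow> bool" where
  "is_limit_value I M g v \<longleftrightarrow>
     (\<forall>z. AE \<omega> in M. (\<lambda>n. stage_value I M g n \<omega> z) \<longlonglongrightarrow> v)"

definition real_vec :: "int ^ 'd \<Rightarrow> real ^ 'd" where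
  "real_vec z = (\<chi> k. real_of_int (z $ k))"

definition oriented :: "(int ^ 'd) set \<Rightarrow> bool" where
  "oriented I \<longleftrightarrow> 0 \<notin> convex hull (real_vec ` I)"

end

theory Submission
  imports Defs
begin

text \<open>For \<open>p \<le> q\<close>, keeping each open edge of a \<open>Bernoulli(q)\<close> configuration independently with
  probability \<open>p / q\<close> gives a \<open>Bernoulli(p)\<close> configuration, in which a play that is optimal for \<open>q\<close>
  keeps on average the fraction \<open>p / q\<close> of its payoff.  Hence
  \<open>(p / q) v\<^sub>\<infinity>(q) \<le> v\<^sub>\<infinity>(p) \<le> v\<^sub>\<infinity>(q)\<close>, and \<open>v\<^sub>\<infinity> \<le> 1\<close> makes \<open>v\<^sub>\<infinity>\<close> Lipschitz with constant
  \<open>1 / p\<^sub>0\<close> on \<open>[p\<^sub>0, 1]\<close>.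

  In the oriented case a play never uses an edge twice, so its total payoff over \<open>n\<close> stages is
  binomial.  Summing exponential moments over the \<open>card I ^ n\<close> plays gives
  \<open>v\<^sub>\<infinity>(p) \<le> (ln (card I) + p e\<^sup>l) / l\<close> for every \<open>l > 0\<close>; let \<open>p \<rightarrow> 0\<close> and then \<open>l \<rightarrow> \<infinity>\<close>.\<close>

section \<open>Plays from the origin and their best total payoff\<close>

definition plays :: "'a set \<Rightarrow> nat \<Rightarrow> (nat \<Rightarrow> 'a) set" where
  "plays I n = ({..<n} \<rightarrow>\<^sub>E I)"

text \<open>The pair of current state and chosen action at stage \<open>m\<close> of the play that
  starts at 0, that is, the index of the payoff collected there.\<close>

definition edge :: "(nat \<Rightarrow> 'a::comm_monoid_add) \<Rightarrow> nat \<Rightarrow> 'a \<times> 'a" where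
  "edge i m = (\<Sum>k<m. i k, i m)"

text \<open>The window of payoffs that can influence the first \<open>n\<close> stages from 0. It is
  finite for finite \<open>I\<close>, so \<open>Pi_pmf\<close> can model it.\<close>

definition edges :: "'a::comm_monoid_add set \<Rightarrow> nat \<Rightarrow> ('a \<times> 'a) set" where
  "edges I n = (\<Union>i\<in>plays I n. edge i ` {..<n})"

definition score :: "nat \<Rightarrow> ('a::comm_monoid_add \<times> 'a \<Rightarrow> real) \<Rightarrow> (nat \<Rightarrow> 'a) \<Rightarrow> real" where
  "score n h i = (\<Sum>m<n. h (edge i m))"

definition best :: "'a::comm_monoid_add set \<Rightarrow> nat \<Rightarrow> ('a \<times> 'a \<Rightarrow> real) \<Rightarrow> real" where
  "best I n h = Max (score n h ` plays I n)"

text \<open>The mean of \<open>n\<close> times the \<open>n\<close>-stage value at 0, taken over a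
  canonical finite product. The probability spaces carrying the PMDPs for different \<open>p\<close>
  are unrelated, so comparing two parameters needs a description in terms of \<open>I\<close>,
  \<open>n\<close> and \<open>p\<close> alone.\<close>

definition mean_best :: "'a::comm_monoid_add set \<Rightarrow> nat \<Rightarrow> real \<Rightarrow> real" where
  "mean_best I n p = measure_pmf.expectation (Pi_pmf (edges I n) False (\<lambda>_. bernoulli_pmf p))
     (\<lambda>b. best I n (\<lambda>e. of_bool (b e)))"

lemma finite_plays: "finite I \<Longrightarrow> finite (plays I n)"
  by (simp add: plays_def finite_PiE)

lemma card_plays: "card (plays I n) = card I ^ n"
  by (simp add: plays_def card_PiE)

lemma plays_nonempty: "I \<noteq> {} \<Longrightarrow> plays I n \<noteq> {}"
  by (auto simp: plays_def PiE_eq_empty_iff)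

lemma finite_edges: "finite I \<Longrightarrow> finite (edges I n)"
  by (simp add: edges_def finite_plays)

lemma edges_subset: "edges I n \<subseteq> UNIV \<times> I"
  by (auto simp: edges_def plays_def edge_def)

lemma edge_in_edges: "i \<in> plays I n \<Longrightarrow> m < n \<Longrightarrow> edge i m \<in> edges I n"
  by (auto simp: edges_def)

lemma edges_nonempty:
  assumes "I \<noteq> {}" "n > 0"
  shows "edges I n \<noteq> {}"
proof -
  obtain i where "i \<in> plays I n" using plays_nonempty[OF assms(1)] by blast
  then show ?thesis using edge_in_edges[of i I n 0] assms(2) by auto
qed

lemma score_le_best: "finite I \<Longrightarrow> i \<in> plays I n \<Longrightarrow> score n h i \<le> best I n h"
  by (simp add: best_def finite_plays)

lemma best_attained:
  assumes "finite I" "I \<noteq> {}"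
  obtains i where "i \<in> plays I n" "best I n h = score n h i"
proof -
  have "Max (score n h ` plays I n) \<in> score n h ` plays I n"
    using assms by (intro Max_in) (auto simp: finite_plays plays_nonempty)
  then show ?thesis using that by (auto simp: best_def)
qed

lemma best_mono:
  assumes "finite I" "I \<noteq> {}" and "\<And>e. h e \<le> h' e"
  shows "best I n h \<le> best I n h'"
proof -
  obtain i where i: "i \<in> plays I n" "best I n h = score n h i"
    using best_attained assms(1,2) by blast
  then have "best I n h \<le> score n h' i"
    by (simp add: score_def sum_mono assms(3))
  also have "\<dots> \<le> best I n h'" using i assms by (intro score_le_best)
  finally show ?thesis .
qed

text \<open>Lets \<open>best\<close> be evaluated on the product space over
  \<open>edges I n\<close>, whose elements are extensional functions.\<close>

lemma best_restrict: "best I n (restrict h (edges I n)) = best I n h"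
proof -
  have "score n (restrict h (edges I n)) i = score n h i" if "i \<in> plays I n" for i
    using that by (auto simp: score_def edge_in_edges intro!: sum.cong)
  then show ?thesis by (simp add: best_def cong: image_cong)
qed

lemma best_bounds:
  assumes "finite I" "I \<noteq> {}" and "\<And>e. e \<in> UNIV \<times> I \<Longrightarrow> h e \<in> {a..b}"
  shows "best I n h \<in> {n * a..n * b}"
proof -
  obtain i where i: "i \<in> plays I n" "best I n h = score n h i"
    using best_attained assms(1,2) by blast
  have "h (edge i m) \<in> {a..b}" if "m < n" for m
    using edge_in_edges[OF i(1) that] edges_subset[of I n] assms(3) by blast
  then have "(\<Sum>m<n. a) \<le> score n h i" "score n h i \<le> (\<Sum>m<n. b)"
    unfolding score_def by (intro sum_mono; simp)+
  then show ?thesis by (simp add: i(2))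
qed

lemma measurable_best:
  assumes "finite I"
  shows "best I n \<in> borel_measurable (PiM (edges I n) (\<lambda>_. borel))"
proof -
  have "(\<lambda>h. score n h i) \<in> borel_measurable (PiM (edges I n) (\<lambda>_. borel))"
    if "i \<in> plays I n" for i
    unfolding score_def using that
    by (intro borel_measurable_sum measurable_component_singleton) (auto simp: edge_in_edges)
  then show ?thesis
    unfolding best_def[abs_def] by (intro borel_measurable_Max finite_plays assms)
qed

section \<open>The stage value as a maximum over finitely many plays\<close>

context PMDP
begin

text \<open>Constancy is in \<omega> and the starting state, not in the stage. Thus every sequence
  of actions is realised by a strategy.\<close>

lemma constant_strategy:
  assumes "\<And>m. i m \<in> I"
  shows "(\<lambda>m _ _. i m) \<in> strategies I M g"
  using assms by (simp add: strategies_def case_prod_unfold)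

lemma strategy_in_actions:
  assumes "\<sigma> \<in> strategies I M g" "\<omega> \<in> space M"
  shows "\<sigma> m \<omega> z \<in> I"
proof -
  have "(\<lambda>(\<omega>, z). \<sigma> m \<omega> z) \<in> F_all I M g \<Otimes>\<^sub>M count_space UNIV \<rightarrow>\<^sub>M count_space I"
    using assms(1) by (simp add: strategies_def)
  moreover have "(\<omega>, z) \<in> space (F_all I M g \<Otimes>\<^sub>M count_space UNIV)"
    using assms(2) by (simp add: space_pair_measure F_all_def space_measure_of_conv)
  ultimately have "(case (\<omega>, z) of (\<omega>, z) \<Rightarrow> \<sigma> m \<omega> z) \<in> space (count_space I)"
    by (rule measurable_space)
  then show ?thesis by simp
qed

lemma state_eq_sum: "state \<sigma> \<omega> z m = z + (\<Sum>k<m. \<sigma> k \<omega> z)"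
  by (induction m) (simp_all add: add.assoc)

lemma payoff_eq_score:
  "payoff g n \<omega> 0 \<sigma> = score n (\<lambda>(z, i). g \<omega> z i) (\<lambda>m. \<sigma> m \<omega> 0) / n"
  by (simp add: payoff_def score_def edge_def state_eq_sum)

text \<open>For fixed \<omega> a strategy matters only through the actions it takes from 0.
  Conversely, the play that is best for this \<omega> is prescribed by a strategy that ignores
  \<omega>, so measurability does not restrict the choice.\<close>

lemma stage_value_eq_best:
  assumes "\<omega> \<in> space M"
  shows "stage_value I M g n \<omega> 0 = best I n (\<lambda>(z, i). g \<omega> z i) / n"
proof -
  let ?h = "\<lambda>(z, i). g \<omega> z i"
  have "payoff g n \<omega> 0 ` strategies I M g = (\<lambda>x. x / n) ` score n ?h ` plays I n"
  proof (intro equalityI subsetI)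
    fix x assume "x \<in> payoff g n \<omega> 0 ` strategies I M g"
    then obtain \<sigma> where \<sigma>: "\<sigma> \<in> strategies I M g" "x = payoff g n \<omega> 0 \<sigma>" by auto
    let ?i = "restrict (\<lambda>m. \<sigma> m \<omega> 0) {..<n}"
    have "?i \<in> plays I n"
      using strategy_in_actions[OF \<sigma>(1) assms] by (auto simp: plays_def)
    moreover have "x = score n ?h ?i / n"
      unfolding \<sigma>(2) payoff_eq_score score_def edge_def
      by (auto intro!: sum.cong arg_cong[where f = "\<lambda>x. x / n"] arg_cong2[where f = "g \<omega>"])
    ultimately show "x \<in> (\<lambda>x. x / n) ` score n ?h ` plays I n" by blast
  next
    fix x assume "x \<in> (\<lambda>x. x / n) ` score n ?h ` plays I n"
    then obtain i where i: "i \<in> plays I n" "x = score n ?h i / n" by auto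
    \<comment> \<open>\<open>c\<close> fills the stages from \<open>n\<close> on, where
      \<open>i\<close> is \<open>undefined\<close> but a strategy must still act within
      \<open>I\<close>.\<close>
    obtain c where "c \<in> I" using nonempty_actions by auto
    let ?i = "\<lambda>m. if m < n then i m else c"
    have "?i m \<in> I" for m using i(1) \<open>c \<in> I\<close> by (auto simp: plays_def)
    then have "(\<lambda>m _ _. ?i m) \<in> strategies I M g" by (rule constant_strategy)
    moreover have "x = payoff g n \<omega> 0 (\<lambda>m _ _. ?i m)"
      unfolding i(2) payoff_eq_score score_def edge_def
      by (auto intro!: sum.cong arg_cong[where f = "\<lambda>x. x / n"] arg_cong2[where f = "g \<omega>"])
    ultimately show "x \<in> payoff g n \<omega> 0 ` strategies I M g" by blast
  qed
  moreover have "Max ((\<lambda>x. x / n) ` score n ?h ` plays I n) = Max (score n ?h ` plays I n) / n"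
    using mono_Max_commute[of "\<lambda>x::real. x / n" "score n ?h ` plays I n"]
    by (simp add: monoI divide_right_mono finite_plays finite_actions plays_nonempty nonempty_actions)
  ultimately show ?thesis
    by (simp add: stage_value_def best_def)
qed

end

section \<open>From the limit value to means over finite products\<close>

context bernoulli_PMDP
begin

lemma random_variable_payoff: "i \<in> I \<Longrightarrow> (\<lambda>\<omega>. g \<omega> z i) \<in> borel_measurable M"
  using independent by (force simp: indep_vars_def)

text \<open>Independence turns each side into the product of its one-coordinate laws, and these
  agree because every payoff is Bernoulli.\<close>

lemma distr_payoffs:
  assumes E: "finite E" "E \<noteq> {}" "E \<subseteq> UNIV \<times> I"
  shows "distr M (PiM E (\<lambda>_. borel)) (\<lambda>\<omega>. \<lambda>(z, i)\<in>E. g \<omega> z i) =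
    distr (measure_pmf (Pi_pmf E False (\<lambda>_. bernoulli_pmf p))) (PiM E (\<lambda>_. borel)) (\<lambda>b. \<lambda>e\<in>E. of_bool (b e))"
    (is "_ = distr ?P _ _")
proof -
  note P = prob_space_measure_pmf[of "Pi_pmf E False (\<lambda>_. bernoulli_pmf p)"]
  let ?X = "\<lambda>(z, i) \<omega>. g \<omega> z i"
  have "indep_vars (\<lambda>_. borel) ?X E"
    using independent E(3) by (rule indep_vars_subset)
  moreover have "?X e \<in> borel_measurable M" if "e \<in> E" for e
    using that E(3) random_variable_payoff by auto
  ultimately have "distr M (PiM E (\<lambda>_. borel)) (\<lambda>\<omega>. \<lambda>e\<in>E. ?X e \<omega>) =
      PiM E (\<lambda>e. distr M borel (?X e))"
    using indep_vars_iff_distr_eq_PiM'[OF E(2), of ?X "\<lambda>_. borel"] by blast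
  also have "\<dots> = PiM E (\<lambda>e. distr ?P borel (\<lambda>b. of_bool (b e)))"
  proof (intro PiM_cong refl)
    fix e assume "e \<in> E"
    then have "distr M borel (?X e) = distr (bernoulli_pmf p) borel of_bool"
      using bernoulli_payoffs E(3) by auto
    also have "\<dots> = distr (map_pmf (\<lambda>b. b e) (Pi_pmf E False (\<lambda>_. bernoulli_pmf p))) borel of_bool"
      using Pi_pmf_component[OF E(1)] \<open>e \<in> E\<close> by metis
    also have "\<dots> = distr ?P borel (\<lambda>b. of_bool (b e))"
      by (simp add: map_pmf_rep_eq distr_distr comp_def)
    finally show "distr M borel (?X e) = distr ?P borel (\<lambda>b. of_bool (b e))" .
  qed
  also have "\<dots> = distr ?P (PiM E (\<lambda>_. borel)) (\<lambda>b. \<lambda>e\<in>E. of_bool (b e))"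
  proof -
    have "prob_space.indep_vars ?P (\<lambda>_. borel) (\<lambda>e b. of_bool (b e) :: real) E"
      using prob_space.indep_vars_compose2[OF P indep_vars_Pi_pmf[OF E(1)],
          of "\<lambda>_. of_bool :: bool \<Rightarrow> real" "\<lambda>_. borel"] by simp
    then show ?thesis
      by (subst (asm) prob_space.indep_vars_iff_distr_eq_PiM'[OF P E(2)]) simp_all
  qed
  finally show ?thesis by (simp add: case_prod_unfold)
qed

lemma measurable_best_payoffs:
  "(\<lambda>\<omega>. best I n (\<lambda>(z, i). g \<omega> z i)) \<in> borel_measurable M"
proof -
  have "(\<lambda>\<omega>. \<lambda>e\<in>edges I n. case e of (z, i) \<Rightarrow> g \<omega> z i) \<in> M \<rightarrow>\<^sub>M PiM (edges I n) (\<lambda>_. borel)"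
    using edges_subset[of I n] random_variable_payoff by (intro measurable_restrict) auto
  from measurable_compose[OF this measurable_best[OF finite_actions]]
  show ?thesis by (simp add: best_restrict)
qed

lemma expectation_best:
  assumes "n > 0"
  shows "expectation (\<lambda>\<omega>. best I n (\<lambda>(z, i). g \<omega> z i)) = mean_best I n p"
proof -
  let ?E = "edges I n" and ?B = "PiM (edges I n) (\<lambda>_. borel) :: ((int ^ 'd) \<times> (int ^ 'd) \<Rightarrow> real) measure"
  let ?P = "measure_pmf (Pi_pmf ?E False (\<lambda>_. bernoulli_pmf p))"
  have [measurable]: "best I n \<in> borel_measurable ?B"
    by (rule measurable_best[OF finite_actions])
  have [measurable]: "(\<lambda>\<omega>. \<lambda>(z, i)\<in>?E. g \<omega> z i) \<in> M \<rightarrow>\<^sub>M ?B"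
    using edges_subset[of I n] random_variable_payoff by (intro measurable_restrict) auto
  have "expectation (\<lambda>\<omega>. best I n (\<lambda>(z, i). g \<omega> z i)) =
      expectation (\<lambda>\<omega>. best I n (\<lambda>(z, i)\<in>?E. g \<omega> z i))"
    by (simp add: best_restrict)
  also have "\<dots> = integral\<^sup>L (distr M ?B (\<lambda>\<omega>. \<lambda>(z, i)\<in>?E. g \<omega> z i)) (best I n)"
    by (simp add: integral_distr)
  also have "\<dots> = integral\<^sup>L (distr ?P ?B (\<lambda>b. \<lambda>e\<in>?E. of_bool (b e))) (best I n)"
    by (subst distr_payoffs)
      (simp_all add: finite_edges finite_actions edges_nonempty nonempty_actions assms edges_subset)
  also have "\<dots> = integral\<^sup>L ?P (\<lambda>b. best I n (\<lambda>e\<in>?E. of_bool (b e)))"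
    by (subst integral_distr) (auto simp: space_PiM)
  also have "\<dots> = mean_best I n p"
    by (simp add: mean_best_def best_restrict)
  finally show ?thesis .
qed

text \<open>The values are uniformly bounded, so dominated convergence turns the almost sure limit
  into a limit of expectations. This determines \<open>v\<close> from \<open>I\<close> and
  \<open>p\<close> alone.\<close>

lemma limit_value_eq_lim_mean_best:
  assumes "is_limit_value I M g v"
  shows "(\<lambda>n. mean_best I n p / n) \<longlonglongrightarrow> v"
proof -
  let ?f = "\<lambda>n \<omega>. best I n (\<lambda>(z, i). g \<omega> z i) / n"
  obtain C where C: "\<And>\<omega> z i. \<omega> \<in> space M \<Longrightarrow> i \<in> I \<Longrightarrow> \<bar>g \<omega> z i\<bar> \<le> C"
    using uniformly_bounded by blast
  \<comment> \<open>At \<open>n = 0\<close> division by zero yields 0, which the absolute value of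
    \<open>C\<close> bounds as well.\<close>
  have bound: "\<bar>?f n \<omega>\<bar> \<le> \<bar>C\<bar>" if "\<omega> \<in> space M" for n \<omega>
  proof (cases "n = 0")
    case False
    have "best I n (\<lambda>(z, i). g \<omega> z i) \<in> {n * (-\<bar>C\<bar>)..n * \<bar>C\<bar>}"
    proof (rule best_bounds[OF finite_actions nonempty_actions])
      fix e :: "(int ^ 'd) \<times> (int ^ 'd)" assume "e \<in> UNIV \<times> I"
      then have "\<bar>case e of (z, i) \<Rightarrow> g \<omega> z i\<bar> \<le> C" using C[OF that] by auto
      then show "(case e of (z, i) \<Rightarrow> g \<omega> z i) \<in> {-\<bar>C\<bar>..\<bar>C\<bar>}" by simp linarith
    qed
    then show ?thesis using False by (auto simp: abs_le_iff field_simps)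
  qed simp
  have "AE \<omega> in M. (\<lambda>n. stage_value I M g n \<omega> 0) \<longlonglongrightarrow> v"
    using assms by (simp add: is_limit_value_def)
  then have "AE \<omega> in M. (\<lambda>n. ?f n \<omega>) \<longlonglongrightarrow> v"
    using AE_space by eventually_elim (simp add: stage_value_eq_best)
  then have "(\<lambda>n. expectation (?f n)) \<longlonglongrightarrow> expectation (\<lambda>_. v)"
    using bound measurable_best_payoffs
    by (intro integral_dominated_convergence[where w = "\<lambda>_. \<bar>C\<bar>"]) auto
  moreover have "eventually (\<lambda>n. expectation (?f n) = mean_best I n p / n) sequentially"
    using eventually_gt_at_top[of 0] by eventually_elim (simp add: expectation_best)
  ultimately show ?thesis
    using tendsto_cong[of "\<lambda>n. expectation (?f n)" "\<lambda>n. mean_best I n p / n" sequentially v]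
    by (simp only: prob_space lebesgue_integral_const) simp
qed

end

section \<open>Coupling of two parameters by thinning\<close>

lemma finite_set_Pi_bernoulli:
  assumes "finite E"
  shows "finite (set_pmf (Pi_pmf E False (\<lambda>_. bernoulli_pmf p)))"
proof -
  have "finite (PiE_dflt E False (\<lambda>_. UNIV :: bool set))" using assms by auto
  then show ?thesis
    by (rule finite_subset[rotated]) (auto simp: set_Pi_pmf assms PiE_dflt_def)
qed

lemma integrable_Pi_bernoulli:
  fixes f :: "('a \<Rightarrow> bool) \<Rightarrow> real"
  shows "finite E \<Longrightarrow> integrable (Pi_pmf E False (\<lambda>_. bernoulli_pmf p)) f"
  by (intro integrable_measure_pmf_finite finite_set_Pi_bernoulli)

text \<open>Two independent coins that must both succeed. The second sits inside a bind so that
  \<open>Pi_pmf_bind\<close> can lift the identity to configurations.\<close>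

lemma bernoulli_pmf_mult:
  assumes "q \<in> {0..1}" "r \<in> {0..1}"
  shows "bernoulli_pmf (q * r) = bernoulli_pmf q \<bind> (\<lambda>a. map_pmf ((\<and>) a) (bernoulli_pmf r))"
proof (rule pmf_eqI)
  fix b
  have qr: "0 \<le> q * r" "q * r \<le> 1" using assms by (auto intro: mult_le_one)
  have "pmf (map_pmf ((\<and>) a) (bernoulli_pmf r)) b = (if a then pmf (bernoulli_pmf r) b else of_bool (\<not> b))" for a
  proof (cases a)
    case True
    then have "(\<and>) a = id" by auto
    with True show ?thesis by simp
  next
    case False
    then have "(\<and>) a = (\<lambda>_. False)" by auto
    with False show ?thesis by (cases b) (simp_all add: map_pmf_const)
  qed
  then show "pmf (bernoulli_pmf (q * r)) b =
      pmf (bernoulli_pmf q \<bind> (\<lambda>a. map_pmf ((\<and>) a) (bernoulli_pmf r))) b"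
    using assms qr by (cases b) (auto simp: pmf_bind algebra_simps)
qed

lemma Pi_bernoulli_thinning:
  assumes "finite E" "q \<in> {0..1}" "r \<in> {0..1}"
  shows "Pi_pmf E False (\<lambda>_. bernoulli_pmf (q * r)) =
    Pi_pmf E False (\<lambda>_. bernoulli_pmf q) \<bind>
      (\<lambda>a. map_pmf (\<lambda>b e. a e \<and> b e) (Pi_pmf E False (\<lambda>_. bernoulli_pmf r)))"
proof -
  let ?Q = "Pi_pmf E False (\<lambda>_. bernoulli_pmf q)" and ?R = "Pi_pmf E False (\<lambda>_. bernoulli_pmf r)"
  \<comment> \<open>Off \<open>E\<close> the product has default value \<open>False\<close>; the
    assumption on \<open>a\<close> makes the conjunction \<open>False\<close> there too. It holds on
    the support of \<open>?Q\<close>.\<close>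
  have inner: "Pi_pmf E False (\<lambda>e. map_pmf ((\<and>) (a e)) (bernoulli_pmf r)) = map_pmf (\<lambda>b e. a e \<and> b e) ?R"
    if "\<And>e. e \<notin> E \<Longrightarrow> \<not> a e" for a
  proof -
    have "Pi_pmf E False (\<lambda>e. map_pmf ((\<and>) (a e)) (bernoulli_pmf r)) =
        ?R \<bind> (\<lambda>b. Pi_pmf E False (\<lambda>e. return_pmf (a e \<and> b e)))"
      unfolding map_pmf_def by (rule Pi_pmf_bind[OF assms(1)])
    also have "\<dots> = ?R \<bind> (\<lambda>b. return_pmf (\<lambda>e. a e \<and> b e))"
      using that by (intro bind_pmf_cong refl) (auto simp: Pi_pmf_return_pmf assms(1) fun_eq_iff)
    finally show ?thesis by (simp add: map_pmf_def)
  qed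
  have "Pi_pmf E False (\<lambda>_. bernoulli_pmf (q * r)) =
      ?Q \<bind> (\<lambda>a. Pi_pmf E False (\<lambda>e. map_pmf ((\<and>) (a e)) (bernoulli_pmf r)))"
    unfolding bernoulli_pmf_mult[OF assms(2,3)] by (rule Pi_pmf_bind[OF assms(1)])
  also have "\<dots> = ?Q \<bind> (\<lambda>a. map_pmf (\<lambda>b e. a e \<and> b e) ?R)"
    by (intro bind_pmf_cong refl inner) (auto simp: set_Pi_pmf assms(1) PiE_dflt_def)
  finally show ?thesis .
qed

text \<open>Thinning only closes edges, which gives the upper bound. For the lower bound, keep the
  play that is optimal before thinning: each of its open edges survives with probability
  \<open>r\<close>, and linearity of expectation applies even when the play repeats edges.\<close>

lemma mean_best_thinning:
  assumes I: "finite I" "I \<noteq> {}" and "q \<in> {0..1}" "r \<in> {0..1}"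
  shows "mean_best I n (q * r) \<in> {r * mean_best I n q..mean_best I n q}"
proof -
  let ?E = "edges I n"
  let ?Q = "Pi_pmf ?E False (\<lambda>_. bernoulli_pmf q)" and ?R = "Pi_pmf ?E False (\<lambda>_. bernoulli_pmf r)"
  let ?F = "\<lambda>b. best I n (\<lambda>e. of_bool (b e))"
  let ?G = "\<lambda>a. measure_pmf.expectation ?R (\<lambda>b. ?F (\<lambda>e. a e \<and> b e))"
  note fin = finite_edges[OF I(1), of n]
  note int = integrable_Pi_bernoulli[OF fin]
  \<comment> \<open>Conditions on the unthinned configuration \<open>a\<close>; \<open>?G a\<close>
    is the mean after thinning it.\<close>
  have eq: "mean_best I n (q * r) = measure_pmf.expectation ?Q ?G"
    unfolding mean_best_def Pi_bernoulli_thinning[OF fin assms(3,4)]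
    by (subst pmf_expectation_bind[where A = "set_pmf ?Q"], simp_all only: set_map_pmf finite_imageI
        finite_set_Pi_bernoulli[OF fin] order_refl, subst integral_measure_pmf[where A = "set_pmf ?Q"])
      (auto simp: finite_set_Pi_bernoulli[OF fin])
  have "?G a \<le> ?F a" for a
  proof -
    have "?G a \<le> measure_pmf.expectation ?R (\<lambda>_. ?F a)"
      by (intro integral_mono int best_mono I) auto
    then show ?thesis by simp
  qed
  then have "measure_pmf.expectation ?Q ?G \<le> mean_best I n q"
    unfolding mean_best_def by (intro integral_mono int)
  moreover have "r * ?F a \<le> ?G a" for a
  proof -
    \<comment> \<open>\<open>i\<close> depends on \<open>a\<close> only, so it is a fixed play when
      averaging over \<open>b\<close>.\<close>
    obtain i where i: "i \<in> plays I n" "?F a = score n (\<lambda>e. of_bool (a e)) i"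
      using best_attained I by blast
    have marginal: "measure_pmf.expectation ?R (\<lambda>b. of_bool (b e)) = r" if "e \<in> ?E" for e
    proof -
      have "measure_pmf.expectation ?R (\<lambda>b. of_bool (b e) :: real) =
          measure_pmf.expectation (map_pmf (\<lambda>b. b e) ?R) of_bool"
        by (simp add: integral_map_pmf)
      also have "\<dots> = r"
        using that assms(4) by (subst Pi_pmf_component[OF fin]) simp
      finally show ?thesis .
    qed
    have "r * ?F a = (\<Sum>m<n. of_bool (a (edge i m)) * r)"
      by (simp add: i score_def sum_distrib_left mult.commute)
    also have "\<dots> = (\<Sum>m<n. of_bool (a (edge i m)) *
        measure_pmf.expectation ?R (\<lambda>b. of_bool (b (edge i m))))"
      using marginal edge_in_edges[OF i(1)] by (intro sum.cong) auto
    also have "\<dots> = measure_pmf.expectation ?R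
        (\<lambda>b. score n (\<lambda>e. of_bool (a e \<and> b e)) i)"
      unfolding score_def by (simp only: of_bool_conj Bochner_Integration.integral_sum int integral_mult_right_zero)
    also have "\<dots> \<le> ?G a"
      by (intro integral_mono int score_le_best I i)
    finally show ?thesis .
  qed
  then have "measure_pmf.expectation ?Q (\<lambda>a. r * ?F a) \<le> measure_pmf.expectation ?Q ?G"
    by (intro integral_mono int)
  then have "r * mean_best I n q \<le> measure_pmf.expectation ?Q ?G"
    by (simp add: mean_best_def)
  ultimately show ?thesis by (simp add: eq)
qed

section \<open>Trivial and exponential-moment bounds on the mean\<close>

lemma mean_best_bounds:
  assumes I: "finite I" "I \<noteq> {}"
  shows "mean_best I n p \<in> {0..real n}"
proof -
  let ?Q = "Pi_pmf (edges I n) False (\<lambda>_. bernoulli_pmf p)"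
  let ?F = "\<lambda>b. best I n (\<lambda>e. of_bool (b e))"
  note int = integrable_Pi_bernoulli[OF finite_edges[OF I(1), of n]]
  have bnd: "?F b \<in> {0..real n}" for b
    using best_bounds[OF I, of "\<lambda>e. of_bool (b e)" 0 1 n] by auto
  have "measure_pmf.expectation ?Q (\<lambda>_. 0) \<le> measure_pmf.expectation ?Q ?F"
    "measure_pmf.expectation ?Q ?F \<le> measure_pmf.expectation ?Q (\<lambda>_. real n)"
    by (intro integral_mono int; use bnd in simp)+
  then show ?thesis by (simp add: mean_best_def)
qed

text \<open>By injectivity the play collects \<open>n\<close> distinct, hence independent, Bernoulli
  payoffs, so the exponential factors into \<open>n\<close> equal moments.\<close>

lemma expectation_exp_score:
  assumes "finite I" and "p \<in> {0..1}"
    and i: "i \<in> plays I n" and inj: "inj_on (edge i) {..<n}"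
  shows "measure_pmf.expectation (Pi_pmf (edges I n) False (\<lambda>_. bernoulli_pmf p))
     (\<lambda>b. exp (l * score n (\<lambda>e. of_bool (b e)) i)) = (1 + p * (exp l - 1)) ^ n"
proof -
  let ?E = "edges I n" and ?J = "edge i ` {..<n}"
  \<comment> \<open>The factor 1 off the play extends the product to all coordinates of the
    \<open>Pi_pmf\<close>.\<close>
  let ?f = "\<lambda>e b. if e \<in> ?J then exp (l * of_bool b) else 1"
  note fin = finite_edges[OF assms(1), of n]
  have sub: "?J \<subseteq> ?E" using edge_in_edges[OF i] by auto
  have "exp (l * score n (\<lambda>e. of_bool (b e)) i) = (\<Prod>e\<in>?E. ?f e (b e))" for b
  proof -
    have "exp (l * score n (\<lambda>e. of_bool (b e)) i) = (\<Prod>m<n. exp (l * of_bool (b (edge i m))))"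
      by (simp only: score_def sum_distrib_left exp_sum finite_lessThan)
    also have "\<dots> = (\<Prod>e\<in>?J. exp (l * of_bool (b e)))"
      by (simp add: prod.reindex[OF inj])
    also have "\<dots> = (\<Prod>e\<in>?E. ?f e (b e))"
      by (rule prod.mono_neutral_cong_left) (use fin sub in auto)
    finally show ?thesis .
  qed
  then have "measure_pmf.expectation (Pi_pmf ?E False (\<lambda>_. bernoulli_pmf p))
      (\<lambda>b. exp (l * score n (\<lambda>e. of_bool (b e)) i)) =
      (\<Prod>e\<in>?E. measure_pmf.expectation (bernoulli_pmf p) (?f e))"
    by (simp only:, subst expectation_prod_Pi_pmf[OF fin])
      (auto intro!: integrable_measure_pmf_finite)
  also have "\<dots> = (\<Prod>e\<in>?E. if e \<in> ?J then 1 + p * (exp l - 1) else 1)"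
    using assms(2) by (intro prod.cong) (auto simp: algebra_simps)
  also have "\<dots> = (\<Prod>e\<in>?J. 1 + p * (exp l - 1))"
    by (rule prod.mono_neutral_cong_right) (use fin sub in auto)
  also have "\<dots> = (1 + p * (exp l - 1)) ^ n"
    by (simp add: card_image[OF inj])
  finally show ?thesis .
qed

text \<open>The exponential of \<open>l\<close> times the maximum is at most the sum of exponentials
  over all plays, whose mean is explicit; the logarithm of that mean bounds \<open>l\<close> times
  the mean maximum.\<close>

lemma mean_best_le:
  assumes I: "finite I" "I \<noteq> {}" and "p \<in> {0..1}" and "l > 0"
    and inj: "\<And>i. i \<in> plays I n \<Longrightarrow> inj_on (edge i) {..<n}"
  shows "mean_best I n p \<le> n * ((ln (card I) + p * exp l) / l)"
proof -
  let ?P = "Pi_pmf (edges I n) False (\<lambda>_. bernoulli_pmf p)"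
  let ?F = "\<lambda>b. best I n (\<lambda>e. of_bool (b e))"
  let ?Z = "\<lambda>b. \<Sum>i\<in>plays I n. exp (l * score n (\<lambda>e. of_bool (b e)) i)"
  define c where "c = 1 + p * (exp l - 1)"
  \<comment> \<open>The mean of \<open>?Z\<close>: the number of plays times the moment of a single
    play.\<close>
  define a where "a = real (card I) ^ n * c ^ n"
  note int = integrable_Pi_bernoulli[OF finite_edges[OF I(1), of n]]
  have cI: "card I > 0" using I by (simp add: card_gt_0_iff)
  have c: "c \<ge> 1" using assms by (simp add: c_def)
  have a: "a > 0" using c cI by (simp add: a_def)
  have Z: "measure_pmf.expectation ?P ?Z = a"
    using expectation_exp_score[OF I(1) assms(3) _ inj, of _ l]
    by (simp add: Bochner_Integration.integral_sum int card_plays a_def c_def)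
  \<comment> \<open>The right-hand side is the tangent to \<open>ln\<close> at \<open>a\<close>,
    evaluated at \<open>?Z b\<close>. Its mean is \<open>ln a\<close>, so it takes the place of
    Jensen's inequality.\<close>
  have "l * ?F b \<le> ?Z b / a - 1 + ln a" for b
  proof -
    obtain i where i: "i \<in> plays I n" "?F b = score n (\<lambda>e. of_bool (b e)) i"
      using best_attained I by blast
    have "1 + (l * ?F b - ln a) \<le> exp (l * ?F b - ln a)" by (rule exp_ge_add_one_self)
    also have "\<dots> = exp (l * ?F b) / a" using a by (simp add: exp_diff)
    also have "exp (l * ?F b) \<le> ?Z b"
      unfolding i(2) by (rule member_le_sum[OF i(1)]) (auto simp: finite_plays I)
    finally show ?thesis using a by (simp add: divide_right_mono)
  qed
  then have "measure_pmf.expectation ?P (\<lambda>b. l * ?F b) \<le>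
      measure_pmf.expectation ?P (\<lambda>b. ?Z b / a - 1 + ln a)"
    by (intro integral_mono int)
  also have "\<dots> = measure_pmf.expectation ?P ?Z / a - 1 + ln a"
    using int by simp
  also have "\<dots> = n * (ln (card I) + ln c)"
    using Z a c cI by (simp add: a_def ln_mult ln_realpow algebra_simps)
  \<comment> \<open>Uses \<open>ln c \<le> c - 1 = p * (exp l - 1) \<le> p * exp l\<close>.\<close>
  also have "\<dots> \<le> n * (ln (card I) + p * exp l)"
    using ln_le_minus_one[of c] c assms(3)
    by (intro mult_left_mono) (simp_all add: c_def algebra_simps)
  finally show ?thesis
    using \<open>l > 0\<close> by (simp add: mean_best_def field_simps)
qed

text \<open>A hyperplane separating 0 from the convex hull gives a linear functional that is
  positive on every action. It strictly increases along the play, so no state recurs.\<close>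

lemma oriented_inj_on_edge:
  fixes I :: "(int ^ 'd) set"
  assumes "finite I" "oriented I" "i \<in> plays I n"
  shows "inj_on (edge i) {..<n}"
proof -
  let ?S = "convex hull (real_vec ` I)"
  have "closed ?S"
    using assms(1) by (intro compact_imp_closed finite_imp_compact_convex_hull) simp
  then obtain a b where ab: "b > 0" "\<And>x. x \<in> ?S \<Longrightarrow> inner a x > b"
    using separating_hyperplane_closed_0[of ?S] assms(2)
    by (auto simp: oriented_def)
  let ?f = "\<lambda>m. inner a (real_vec (\<Sum>k<m. i k))"
  have step: "?f m < ?f (Suc m)" if "m < n" for m
  proof -
    have "i m \<in> I" using assms(3) that by (auto simp: plays_def)
    then have "inner a (real_vec (i m)) > b" by (intro ab(2) hull_inc) auto
    moreover have "real_vec ((\<Sum>k<m. i k) + i m) = real_vec (\<Sum>k<m. i k) + real_vec (i m)"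
      by (simp add: real_vec_def vec_eq_iff)
    ultimately show ?thesis using ab(1) by (simp add: inner_add_right)
  qed
  have less: "?f m < ?f m'" if "m < m'" "m' < n" for m m'
    using that
  proof (induction m')
    case (Suc m')
    then show ?case using step[of m'] by (cases "m = m'") auto
  qed simp
  show ?thesis
  proof (rule inj_onI)
    fix m m' assume *: "m \<in> {..<n}" "m' \<in> {..<n}" "edge i m = edge i m'"
    then have "?f m = ?f m'" by (simp add: edge_def)
    then show "m = m'" using less[of m m'] less[of m' m] * by (cases m m' rule: linorder_cases) auto
  qed
qed

section \<open>Passage to the limit: Lipschitz bound and continuity at 0\<close>

theorem proposition4p1:
  fixes I :: "(int ^ 'd) set"
    and M :: "real \<Rightarrow> 'w measure"
    and g :: "real \<Rightarrow> 'w \<Rightarrow> int ^ 'd \<Rightarrow> int ^ 'd \<Rightarrow> real"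
    and v_inf :: "real \<Rightarrow> real"
  assumes "finite I" and "I \<noteq> {}" and "I \<noteq> {0}"
    and "\<And>p. p \<in> {0..1} \<Longrightarrow> bernoulli_PMDP I (M p) (g p) p"
    and "\<And>p. p \<in> {0..1} \<Longrightarrow> is_limit_value I (M p) (g p) (v_inf p)"
  shows "(\<forall>p0>0. \<exists>L. L-lipschitz_on {p0..1} v_inf) \<and>
         (oriented I \<longrightarrow> continuous (at 0 within {0..1}) v_inf)"
proof (intro conjI allI impI)
  \<comment> \<open>From here on the inequalities for \<open>v_inf\<close> are limits of
    inequalities between the canonical means.\<close>
  have lim: "(\<lambda>n. mean_best I n p / n) \<longlonglongrightarrow> v_inf p" if "p \<in> {0..1}" for p
    by (rule bernoulli_PMDP.limit_value_eq_lim_mean_best[OF assms(4)[OF that] assms(5)[OF that]])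
  have range: "v_inf p \<in> {0..1}" if "p \<in> {0..1}" for p
  proof -
    have "mean_best I n p / n \<in> {0..1}" for n
      using mean_best_bounds[OF assms(1,2), of n p] by (cases "n = 0") auto
    then show ?thesis
      by (intro closed_sequentially[OF closed_atLeastAtMost _ lim[OF that]]) auto
  qed
  have thinning: "r * v_inf q \<le> v_inf (q * r)" "v_inf (q * r) \<le> v_inf q"
    if "q \<in> {0..1}" "r \<in> {0..1}" for q r
  proof -
    have qr: "q * r \<in> {0..1}" using that by (auto intro: mult_le_one)
    have "r * (mean_best I n q / n) \<le> mean_best I n (q * r) / n"
      "mean_best I n (q * r) / n \<le> mean_best I n q / n" for n
      using mean_best_thinning[OF assms(1,2) that, of n] by (auto intro: divide_right_mono)
    then show "r * v_inf q \<le> v_inf (q * r)" "v_inf (q * r) \<le> v_inf q"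
      by (auto intro!: LIMSEQ_le[OF tendsto_mult_left[OF lim] lim] LIMSEQ_le[OF lim lim] that qr)
  qed
  {
    fix p0 :: real assume p0: "p0 > 0"
    \<comment> \<open>Thinning from \<open>q\<close> with \<open>r = p / q\<close> loses at most the
      fraction \<open>1 - p / q\<close> of \<open>v_inf q \<le> 1\<close>, and
      \<open>q \<ge> p0\<close> turns this into the slope \<open>1 / p0\<close>.\<close>
    have "dist (v_inf p) (v_inf q) \<le> 1 / p0 * dist p q" if "p0 \<le> p" "p \<le> q" "q \<le> 1" for p q
    proof -
      have *: "q \<in> {0..1}" "p / q \<in> {0..1}" "q * (p / q) = p" using that p0 by auto
      have "(1 - p / q) * v_inf q \<le> (1 - p / q) * 1"
        using range[OF *(1)] *(2) by (intro mult_left_mono) auto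
      then have "v_inf q - v_inf p \<le> 1 - p / q"
        using thinning[OF *(1,2)] *(3) by (simp add: algebra_simps)
      also have "\<dots> = (q - p) / q" using that p0 by (simp add: field_simps)
      also have "\<dots> \<le> (q - p) / p0" using that p0 by (intro divide_left_mono) auto
      finally show ?thesis using thinning[OF *(1,2)] *(3) that by (simp add: dist_real_def)
    qed
    then have "(1 / p0)-lipschitz_on {p0..1} v_inf"
      using p0 by (intro lipschitz_on_leI) auto
    then show "\<exists>L. L-lipschitz_on {p0..1} v_inf" by blast
  }
  assume "oriented I"
  have bound: "v_inf p \<le> (ln (card I) + p * exp l) / l" if "p \<in> {0..1}" "l > 0" for p l
  proof (rule LIMSEQ_le_const2[OF lim[OF that(1)]], intro exI allI impI)
    fix n :: nat assume "1 \<le> n"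
    then show "mean_best I n p / n \<le> (ln (card I) + p * exp l) / l"
      using mean_best_le[OF assms(1,2) that oriented_inj_on_edge[OF assms(1) \<open>oriented I\<close>], of n]
      by (simp add: divide_le_eq mult.commute)
  qed
  \<comment> \<open>\<open>l\<close> is chosen first, to make the entropy term small. The added 1 in
    the witness keeps it positive when \<open>card I = 1\<close> and makes the inequality
    strict.\<close>
  have level: "\<exists>l>0. ln (card I) / l < e" if "e > 0" for e
  proof (intro exI conjI)
    have "card I \<ge> 1" using assms(1,2) by (simp add: Suc_le_eq card_gt_0_iff)
    then have "ln (card I) \<ge> 0" by simp
    then show "(ln (card I) + 1) / e > 0" "ln (card I) / ((ln (card I) + 1) / e) < e"
      using that by (auto simp: field_simps)
  qed
  \<comment> \<open>With \<open>l\<close> fixed, the bound tends to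
    \<open>ln (card I) / l < e\<close> as \<open>p\<close> tends to 0.\<close>
  have small: "eventually (\<lambda>p. v_inf p < e) (at 0 within {0..1})" if "e > 0" for e
  proof -
    obtain l where l: "l > 0" "ln (card I) / l < e" using level[OF \<open>e > 0\<close>] by blast
    have "((\<lambda>p. (ln (card I) + p * exp l) / l) \<longlongrightarrow> (ln (card I) + 0 * exp l) / l) (at 0 within {0..1})"
      by (intro tendsto_intros) (use l in auto)
    then have "eventually (\<lambda>p. (ln (card I) + p * exp l) / l < e) (at 0 within {0..1})"
      using l by (intro order_tendstoD(2)) auto
    moreover have "eventually (\<lambda>p. p \<in> {0..1}) (at (0::real) within {0..1})"
      by (simp add: eventually_at_filter)
    ultimately show ?thesis
      by eventually_elim (use bound l in force)
  qed
  have "v_inf 0 = 0"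
  proof (rule antisym)
    show "v_inf 0 \<ge> 0" using range[of 0] by simp
    \<comment> \<open>At \<open>p = 0\<close> the bound is exactly
      \<open>ln (card I) / l\<close>.\<close>
    have "v_inf 0 < e" if "e > 0" for e
      using level[OF that] bound[of 0] by force
    then show "v_inf 0 \<le> 0" by (meson not_less less_irrefl)
  qed
  moreover have "(v_inf \<longlongrightarrow> 0) (at 0 within {0..1})"
  proof (rule order_tendstoI)
    fix e :: real assume "e < 0"
    have "eventually (\<lambda>p. p \<in> {0..1}) (at (0::real) within {0..1})"
      by (simp add: eventually_at_filter)
    then show "eventually (\<lambda>p. e < v_inf p) (at 0 within {0..1})"
      by eventually_elim (use range \<open>e < 0\<close> in force)
  qed (rule small)
  ultimately show "continuous (at 0 within {0..1}) v_inf"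
    by (simp add: continuous_within)
qed

end
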